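(* Let $Q$ be a negative-definite integral quadratic form of rank $n$, let $\delta=|\det Q|$, and let $\Delta_\delta=(n-1)\langle-1\rangle\oplus\langle-\delta\rangle$. (1) Suppose $n\le 3$. Then every characteristic vector $x_0$ for $Q$ is congruent modulo $2$ to a vector $x\in\mathbb{Z}^n$ with $$Q(x,x)+n\ge 1-\delta;$$ moreover, $x$ can be chosen so that the inequality is strict unless $Q=\Delta_\delta$. (2) Suppose $n=2$ and $\delta$ is odd. Then there exists a characteristic covector $y$ for $Q$ with $$Q'(y,y)+n\ge 1-\frac{1}{\delta};$$ moreover, $y$ can be chosen so that the inequality is strict unless $Q=\Delta_\delta$.
   Context: An integral quadratic form $Q$ of rank $n$ is a symmetric bilinear form $Q:\mathbb{Z}^n\times\mathbb{Z}^n\to\mathbb{Z}$, identified with the symmetric integer matrix with entries $Q(e_i,e_j)$. Two matrices $Q_1,Q_2$ represent the same form (written $Q_1=Q_2$) iff $Q_1=P^TQ_2P$ for some $P\in GL(n,\mathbb{Z})$. $\langle a\rangle$ denotes the rank one form with matrix $(a)$, and $(n-1)\langle -1\rangle$ the orthogonal sum of $n-1$ copies of $\langle -1\rangle$. $Q'$ is the induced form on the dual $\mathbb{Z}^n$, given by the inverse matrix $Q^{-1}$. A vector $x\in\mathbb{Z}^n$ is a characteristic vector for $Q$ if $Q(x,\xi)\equiv Q(\xi,\xi)\pmod 2$ for all $\xi\in\mathbb{Z}^n$. An element $y$ of the dual $\mathbb{Z}^n$ is a characteristic covector for $Q$ if $(y,\xi)\equiv Q(\xi,\xi)\pmod 2$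 for all $\xi\in\mathbb{Z}^n$, where $(\cdot,\cdot)$ is the evaluation pairing (the standard dot product in dual bases). Congruence modulo $2$ of vectors means their difference lies in $2\mathbb{Z}^n$. *)

theory Defs
  imports
    "HOL-Number_Theory.Cong"
    "Jordan_Normal_Form.Determinant"
    "Jordan_Normal_Form.Gauss_Jordan_Elimination"
begin

text \<open>An integral quadratic form of rank \<open>n\<close> is a symmetric bilinear form on \<open>\<int>\<^sup>n\<close>; it is identified
  with its Gram matrix. Elements of \<open>\<int>\<^sup>n\<close> are the members of \<open>carrier_vec n :: int vec set\<close>, and
  the dual of \<open>\<int>\<^sup>n\<close> is identified with the same set by means of the dual basis.\<close>

definition integral_form :: "nat \<Rightarrow> int mat \<Rightarrow> bool" where
  "integral_form n Q \<longleftrightarrow> Q \<in> carrier_mat n n \<and> transpose_mat Q = Q"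

definition form_val :: "'a :: comm_ring_1 mat \<Rightarrow> 'a vec \<Rightarrow> 'a vec \<Rightarrow> 'a" where
  "form_val Q x y = x \<bullet> (Q *\<^sub>v y)"

definition negative_definite :: "nat \<Rightarrow> int mat \<Rightarrow> bool" where
  "negative_definite n Q \<longleftrightarrow> (\<forall>x \<in> carrier_vec n. x \<noteq> 0\<^sub>v n \<longrightarrow> form_val Q x x < 0)"

text \<open>Equality of forms: the matrices agree up to a change of basis in \<open>GL(n, \<int>)\<close>. Note that
  \<^const>\<open>invertible_mat\<close> at type \<^typ>\<open>int mat\<close> asks for an inverse with integer entries.\<close>

definition same_form :: "nat \<Rightarrow> int mat \<Rightarrow> int mat \<Rightarrow> bool" where
  "same_form n Q1 Q2 \<longleftrightarrow>
     (\<exists>P \<in> carrier_mat n n. invertible_mat P \<and> Q1 = transpose_mat P * Q2 * P)"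

definition rank_one :: "int \<Rightarrow> int mat" where
  "rank_one a = mat 1 1 (\<lambda>_. a)"

text \<open>The form \<open>(n-1)\<langle>-1\<rangle> \<oplus> \<langle>-\<delta>\<rangle>\<close>, for \<open>n \<ge> 1\<close>. The matrix of an orthogonal sum is block diagonal.\<close>

definition Delta_form :: "nat \<Rightarrow> int \<Rightarrow> int mat" where
  "Delta_form n d = diag_block_mat (replicate (n - 1) (rank_one (-1)) @ [rank_one (-d)])"

text \<open>The induced form on the dual lattice is rational-valued. Its matrix is \<open>Q\<^sup>-\<^sup>1\<close>; this is meaningful
  when \<open>det Q \<noteq> 0\<close>, in particular when \<open>Q\<close> is negative definite.\<close>

definition dual_form_val :: "int mat \<Rightarrow> int vec \<Rightarrow> int vec \<Rightarrow> rat" where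
  "dual_form_val Q y z =
     form_val (the (mat_inverse (map_mat rat_of_int Q)))
       (map_vec rat_of_int y) (map_vec rat_of_int z)"

definition characteristic_vector :: "nat \<Rightarrow> int mat \<Rightarrow> int vec \<Rightarrow> bool" where
  "characteristic_vector n Q x \<longleftrightarrow>
     x \<in> carrier_vec n \<and> (\<forall>\<xi> \<in> carrier_vec n. [form_val Q x \<xi> = form_val Q \<xi> \<xi>] (mod 2))"

definition characteristic_covector :: "nat \<Rightarrow> int mat \<Rightarrow> int vec \<Rightarrow> bool" where
  "characteristic_covector n Q y \<longleftrightarrow>
     y \<in> carrier_vec n \<and> (\<forall>\<xi> \<in> carrier_vec n. [y \<bullet> \<xi> = form_val Q \<xi> \<xi>] (mod 2))"

definition vec_cong_mod2 :: "nat \<Rightarrow> int vec \<Rightarrow> int vec \<Rightarrow> bool" where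
  "vec_cong_mod2 n x y \<longleftrightarrow> (\<exists>z \<in> carrier_vec n. x - y = 2 \<cdot>\<^sub>v z)"

end

theory Submission
  imports Defs
begin

text \<open>The form \<open>-Q\<close> is rewritten as the Laplacian of a weighted graph. For \<open>n = 2, 3\<close>, Selling's
  reduction yields generators \<open>v\<^sub>0, \<dots>, v\<^sub>n\<close> of \<open>\<int>\<^sup>n\<close> with \<open>v\<^sub>0 + \<dots> + v\<^sub>n = 0\<close> and all
  \<open>p\<^sub>i\<^sub>j = Q(v\<^sub>i, v\<^sub>j) \<ge> 0\<close> for \<open>i \<noteq> j\<close> (\<open>binary_obtuse_superbase\<close>, \<open>ternary_obtuse_superbase\<close>). Then
  \<open>-Q(\<Sum> a\<^sub>i v\<^sub>i, \<Sum> a\<^sub>i v\<^sub>i) = \<Sum>\<^sub>i\<^sub><\<^sub>j p\<^sub>i\<^sub>j (a\<^sub>i - a\<^sub>j)\<^sup>2\<close>. Every class modulo 2 contains a vector whose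
  coefficients \<open>a\<^sub>i\<close> are 0 or 1, and on such a vector \<open>-Q\<close> is at most the total weight
  \<open>E = \<Sum>\<^sub>i\<^sub><\<^sub>j p\<^sub>i\<^sub>j\<close>. So part (1) reduces to the inequality \<open>E \<le> \<delta> + n - 1\<close>.

  By the matrix-tree theorem \<open>\<delta>\<close> is the number of spanning trees of the multigraph on
  \<open>v\<^sub>0, \<dots>, v\<^sub>n\<close> with \<open>p\<^sub>i\<^sub>j\<close> parallel edges between \<open>v\<^sub>i\<close> and \<open>v\<^sub>j\<close>. Since \<open>\<delta> \<noteq> 0\<close> there is a spanning
  tree; it has \<open>n\<close> edges, and each of the other \<open>E - n\<close> edges can be exchanged into it, which gives
  \<open>E - n\<close> further spanning trees. Hence \<open>\<delta> \<ge> 1 + E - n\<close>. Equality forces all additional edges to be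
  parallel to one and the same edge of the tree, and in the basis dual to the edges of such a tree
  \<open>Q\<close> is diagonal with entries \<open>-1, \<dots>, -1, -\<delta>\<close>. For \<open>n \<le> 3\<close> the count of exchanges is an
  estimate of explicit polynomials: \<open>selling2_star_bounded\<close> for \<open>n = 2\<close>, and \<open>selling3_star_bounded\<close> and
  \<open>selling3_path_bounded\<close> for the two kinds of trees on four vertices. For \<open>n = 1\<close> the form is
  \<open>\<Delta>\<^sub>\<delta>\<close> itself.

  For part (2), the rotation \<open>(y\<^sub>0, y\<^sub>1) \<mapsto> (y\<^sub>1, -y\<^sub>0)\<close> turns \<open>\<delta> Q'\<close> into \<open>Q\<close> when \<open>n = 2\<close>, because the
  adjugate of a \<open>2 \<times> 2\<close> matrix is obtained by this rotation. The characteristic covectors are the ones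
  congruent to the diagonal of \<open>Q\<close>, so they correspond to a single class modulo 2, to which the bound
  applies.\<close>

section \<open>Equivalence of forms\<close>

lemma form_val_congruence:
  fixes Q :: "int mat"
  assumes "Q \<in> carrier_mat n n" "P \<in> carrier_mat n n" "x \<in> carrier_vec n" "y \<in> carrier_vec n"
  shows "form_val (transpose_mat P * Q * P) x y = form_val Q (P *\<^sub>v x) (P *\<^sub>v y)"
proof -
  have Py: "P *\<^sub>v y \<in> carrier_vec n" and QPy: "Q *\<^sub>v (P *\<^sub>v y) \<in> carrier_vec n"
    using assms by simp_all
  have "(transpose_mat P * Q * P) *\<^sub>v y = (transpose_mat P * Q) *\<^sub>v (P *\<^sub>v y)"
    by (rule assoc_mult_mat_vec[where n\<^sub>2 = n]) (use assms in auto)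
  also have "\<dots> = transpose_mat P *\<^sub>v (Q *\<^sub>v (P *\<^sub>v y))"
    by (rule assoc_mult_mat_vec[where n\<^sub>2 = n]) (use assms in auto)
  finally have "form_val (transpose_mat P * Q * P) x y = (transpose_mat P *\<^sub>v (Q *\<^sub>v (P *\<^sub>v y))) \<bullet> x"
    unfolding form_val_def using assms QPy
    by (simp add: comm_scalar_prod[of x n])
  also have "\<dots> = (Q *\<^sub>v (P *\<^sub>v y)) \<bullet> (P *\<^sub>v x)"
    by (rule transpose_vec_mult_scalar[OF assms(2,3) QPy])
  also have "\<dots> = form_val Q (P *\<^sub>v x) (P *\<^sub>v y)"
    unfolding form_val_def by (rule comm_scalar_prod[OF QPy]) (use assms in simp)
  finally show ?thesis .
qed

text \<open>The inverse is made explicit as a matrix in \<open>carrier_mat n n\<close>: \<^const>\<open>invertible_mat\<close> leaves the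
  dimensions of the inverse to be recovered from the two products.\<close>

lemma same_form_iff:
  "same_form n Q1 Q2 \<longleftrightarrow>
     (\<exists>P\<in>carrier_mat n n. \<exists>R\<in>carrier_mat n n. P * R = 1\<^sub>m n \<and> R * P = 1\<^sub>m n \<and> Q1 = transpose_mat P * Q2 * P)"
proof
  assume "same_form n Q1 Q2"
  then obtain P B where P: "P \<in> carrier_mat n n" "Q1 = transpose_mat P * Q2 * P"
    and B: "P * B = 1\<^sub>m (dim_row P)" "B * P = 1\<^sub>m (dim_row B)"
    unfolding same_form_def invertible_mat_def inverts_mat_def by blast
  have "dim_col B = n" using arg_cong[OF B(1), of dim_col] P by simp
  moreover have "dim_row B = n" using arg_cong[OF B(2), of dim_col] P by simp
  ultimately have "B \<in> carrier_mat n n" by auto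
  with P B show "\<exists>P\<in>carrier_mat n n. \<exists>R\<in>carrier_mat n n. P * R = 1\<^sub>m n \<and> R * P = 1\<^sub>m n \<and> Q1 = transpose_mat P * Q2 * P"
    by auto
next
  assume "\<exists>P\<in>carrier_mat n n. \<exists>R\<in>carrier_mat n n. P * R = 1\<^sub>m n \<and> R * P = 1\<^sub>m n \<and> Q1 = transpose_mat P * Q2 * P"
  then obtain P R where P: "P \<in> carrier_mat n n" and R: "R \<in> carrier_mat n n"
    and PR: "P * R = 1\<^sub>m n" "R * P = 1\<^sub>m n" and Q: "Q1 = transpose_mat P * Q2 * P"
    by blast
  have "inverts_mat P R" "inverts_mat R P"
    unfolding inverts_mat_def using P R PR by simp_all
  moreover have "square_mat P" using P by simp
  ultimately have "invertible_mat P" unfolding invertible_mat_def by blast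
  then show "same_form n Q1 Q2" unfolding same_form_def using P Q by blast
qed

lemma same_formI:
  assumes "P \<in> carrier_mat n n" "R \<in> carrier_mat n n" "P * R = 1\<^sub>m n" "R * P = 1\<^sub>m n"
    and "Q1 = transpose_mat P * Q2 * P"
  shows "same_form n Q1 Q2"
  using assms unfolding same_form_iff by blast

lemma same_form_refl: "Q \<in> carrier_mat n n \<Longrightarrow> same_form n Q Q"
  unfolding same_form_iff
  by (rule bexI[of _ "1\<^sub>m n"], rule bexI[of _ "1\<^sub>m n"]) auto

lemma same_form_sym:
  assumes "same_form n Q1 Q2" "Q2 \<in> carrier_mat n n"
  shows "same_form n Q2 Q1"
proof -
  obtain P R where P: "P \<in> carrier_mat n n" and R: "R \<in> carrier_mat n n"
    and PR: "P * R = 1\<^sub>m n" "R * P = 1\<^sub>m n" and Q: "Q1 = transpose_mat P * Q2 * P"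
    using assms unfolding same_form_iff by blast
  have "transpose_mat R * Q1 * R = transpose_mat R * (transpose_mat P * Q2 * P) * R"
    by (simp add: Q)
  also have "\<dots> = (transpose_mat R * transpose_mat P) * Q2 * (P * R)"
    using P R assms(2) by (simp add: assoc_mult_mat[of _ n n _ n _ n])
  also have "transpose_mat R * transpose_mat P = 1\<^sub>m n"
    using transpose_mult[OF P R] PR by simp
  finally have "Q2 = transpose_mat R * Q1 * R" using PR assms(2) by simp
  then show ?thesis unfolding same_form_iff using P R PR by blast
qed

lemma same_form_trans:
  assumes "same_form n Q1 Q2" "same_form n Q2 Q3" "Q3 \<in> carrier_mat n n"
  shows "same_form n Q1 Q3"
proof -
  obtain P R where P: "P \<in> carrier_mat n n" and R: "R \<in> carrier_mat n n"
    and PR: "P * R = 1\<^sub>m n" "R * P = 1\<^sub>m n" and Q1: "Q1 = transpose_mat P * Q2 * P"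
    using assms(1) unfolding same_form_iff by blast
  obtain S T where S: "S \<in> carrier_mat n n" and T: "T \<in> carrier_mat n n"
    and ST: "S * T = 1\<^sub>m n" "T * S = 1\<^sub>m n" and Q2: "Q2 = transpose_mat S * Q3 * S"
    using assms(2) unfolding same_form_iff by blast
  have "(S * P) * (R * T) = S * (P * R) * T" "(R * T) * (S * P) = R * (T * S) * P"
    using P R S T by (simp_all add: assoc_mult_mat[of _ n n _ n _ n])
  then have inv: "(S * P) * (R * T) = 1\<^sub>m n" "(R * T) * (S * P) = 1\<^sub>m n"
    using P R S T PR ST by simp_all
  have "Q1 = transpose_mat (S * P) * Q3 * (S * P)"
    using P S assms(3) unfolding Q1 Q2 transpose_mult[OF S P]
    by (simp add: assoc_mult_mat[of _ n n _ n _ n])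
  with inv mult_carrier_mat[OF S P] mult_carrier_mat[OF R T] show ?thesis
    unfolding same_form_iff by blast
qed

text \<open>Not only the absolute value is preserved, since \<open>det P\<close> enters squared; the sign decides in the
  binary case that \<open>det Q > 0\<close>.\<close>

lemma same_form_det:
  assumes "same_form n Q1 Q2" "Q2 \<in> carrier_mat n n"
  shows "det Q1 = det Q2"
proof -
  obtain P R where P: "P \<in> carrier_mat n n" and R: "R \<in> carrier_mat n n"
    and PR: "P * R = 1\<^sub>m n" and Q1: "Q1 = transpose_mat P * Q2 * P"
    using assms unfolding same_form_iff by blast
  have "det P * det R = 1" using det_mult[OF P R] PR by simp
  then have "det P = 1 \<or> det P = - 1" using zmult_eq_1_iff by blast
  moreover have "det Q1 = det P * det Q2 * det P"
    unfolding Q1 using P assms(2) by (simp add: det_mult[of _ n] det_transpose)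
  ultimately show ?thesis by auto
qed

lemma same_form_negative_definite:
  assumes "same_form n Q1 Q2" "Q2 \<in> carrier_mat n n" "negative_definite n Q2"
  shows "negative_definite n Q1"
  unfolding negative_definite_def
proof (intro ballI impI)
  fix x :: "int vec" assume x: "x \<in> carrier_vec n" "x \<noteq> 0\<^sub>v n"
  obtain P R where P: "P \<in> carrier_mat n n" and R: "R \<in> carrier_mat n n"
    and PR: "R * P = 1\<^sub>m n" and Q1: "Q1 = transpose_mat P * Q2 * P"
    using assms unfolding same_form_iff by blast
  have "x = R *\<^sub>v (P *\<^sub>v x)"
    using x P R PR by (metis assoc_mult_mat_vec one_mult_mat_vec)
  then have "P *\<^sub>v x \<noteq> 0\<^sub>v n" using x R by auto
  then have "form_val Q2 (P *\<^sub>v x) (P *\<^sub>v x) < 0"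
    using assms(3) P x unfolding negative_definite_def by simp
  then show "form_val Q1 x x < 0"
    unfolding Q1 using form_val_congruence[OF assms(2) P x(1) x(1)] by simp
qed

lemma negative_definite_det_nonzero:
  assumes "Q \<in> carrier_mat n n" "negative_definite n Q"
  shows "det Q \<noteq> 0"
proof
  assume "det Q = 0"
  then obtain v where v: "v \<in> carrier_vec n" "v \<noteq> 0\<^sub>v n" "Q *\<^sub>v v = 0\<^sub>v n"
    using det_0_iff_vec_prod_zero[OF assms(1)] by blast
  then have "form_val Q v v = 0" unfolding form_val_def by simp
  with v assms(2) show False unfolding negative_definite_def by force
qed

section \<open>Short vectors in the classes modulo 2\<close>

text \<open>As a property of the form alone, the bound can be transported along \<^const>\<open>same_form\<close> without
  following a particular class through the change of basis.\<close>

definition classes_bounded :: "nat \<Rightarrow> int mat \<Rightarrow> bool" where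
  "classes_bounded n Q \<longleftrightarrow>
     (\<forall>x\<^sub>0\<in>carrier_vec n. \<exists>x\<in>carrier_vec n. vec_cong_mod2 n x\<^sub>0 x
        \<and> form_val Q x x + int n \<ge> 1 - \<bar>det Q\<bar>
        \<and> (\<not> same_form n Q (Delta_form n \<bar>det Q\<bar>) \<longrightarrow> form_val Q x x + int n > 1 - \<bar>det Q\<bar>))"

lemma Delta_form_carrier: "n \<ge> 1 \<Longrightarrow> Delta_form n d \<in> carrier_mat n n"
  unfolding Delta_form_def carrier_mat_def
  by (simp add: dim_diag_block_mat rank_one_def sum_list_replicate)

lemma classes_bounded_same_form:
  assumes "n \<ge> 1" "same_form n Q1 Q2" "Q2 \<in> carrier_mat n n" "classes_bounded n Q2"
  shows "classes_bounded n Q1"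
  unfolding classes_bounded_def
proof
  fix x\<^sub>0 :: "int vec" assume x0: "x\<^sub>0 \<in> carrier_vec n"
  let ?D = "Delta_form n \<bar>det Q2\<bar>"
  obtain P R where P: "P \<in> carrier_mat n n" and R: "R \<in> carrier_mat n n"
    and PR: "P * R = 1\<^sub>m n" "R * P = 1\<^sub>m n" and Q1: "Q1 = transpose_mat P * Q2 * P"
    using assms(2) unfolding same_form_iff by blast
  have det: "\<bar>det Q1\<bar> = \<bar>det Q2\<bar>" using same_form_det[OF assms(2,3)] by simp
  have "P *\<^sub>v x\<^sub>0 \<in> carrier_vec n" using P x0 by simp
  then obtain u where u: "u \<in> carrier_vec n" and cong: "vec_cong_mod2 n (P *\<^sub>v x\<^sub>0) u"
    and bound: "form_val Q2 u u + int n \<ge> 1 - \<bar>det Q2\<bar>"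
      "\<not> same_form n Q2 ?D \<longrightarrow> form_val Q2 u u + int n > 1 - \<bar>det Q2\<bar>"
    using assms(4) unfolding classes_bounded_def by blast
  let ?x = "R *\<^sub>v u"
  have x: "?x \<in> carrier_vec n" using R u by simp
  obtain z where z: "z \<in> carrier_vec n" "P *\<^sub>v x\<^sub>0 - u = 2 \<cdot>\<^sub>v z"
    using cong unfolding vec_cong_mod2_def by blast
  have "R *\<^sub>v (P *\<^sub>v x\<^sub>0 - u) = R *\<^sub>v (P *\<^sub>v x\<^sub>0) - ?x"
    using R u P x0 by (intro mult_minus_distrib_mat_vec) auto
  also have "R *\<^sub>v (P *\<^sub>v x\<^sub>0) = x\<^sub>0"
    using PR(2) assoc_mult_mat_vec[OF R P x0] x0 by simp
  finally have "x\<^sub>0 - ?x = R *\<^sub>v (P *\<^sub>v x\<^sub>0 - u)" ..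
  also have "\<dots> = 2 \<cdot>\<^sub>v (R *\<^sub>v z)"
    unfolding z(2) using R z(1) by (intro eq_vecI) auto
  finally have "vec_cong_mod2 n x\<^sub>0 ?x"
    unfolding vec_cong_mod2_def using mult_mat_vec_carrier[OF R z(1)] by blast
  moreover have "P *\<^sub>v ?x = u"
    using assoc_mult_mat_vec[OF P R u] PR(1) u by simp
  then have "form_val Q1 ?x ?x = form_val Q2 u u"
    unfolding Q1 form_val_congruence[OF assms(3) P x x] by simp
  moreover have "same_form n Q2 ?D \<Longrightarrow> same_form n Q1 ?D"
    using same_form_trans[OF assms(2)] Delta_form_carrier[OF assms(1)] by blast
  ultimately show "\<exists>x\<in>carrier_vec n. vec_cong_mod2 n x\<^sub>0 x
        \<and> form_val Q1 x x + int n \<ge> 1 - \<bar>det Q1\<bar>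
        \<and> (\<not> same_form n Q1 (Delta_form n \<bar>det Q1\<bar>) \<longrightarrow> form_val Q1 x x + int n > 1 - \<bar>det Q1\<bar>)"
    using x bound unfolding det by (intro bexI[of _ ?x]) auto
qed

text \<open>The remainder modulo 2 in each coordinate is the representative of a class. A number \<open>E\<close> that
  bounds \<open>-Q\<close> on the unit cube, such as the total weight of a graph, only has to be compared with the
  determinant.\<close>

lemma classes_boundedI:
  assumes val: "\<And>x. x \<in> carrier_vec n \<Longrightarrow> (\<And>i. i < n \<Longrightarrow> x $ i \<in> {0, 1}) \<Longrightarrow> form_val Q x x \<ge> - E"
    and le: "E \<le> \<bar>det Q\<bar> + int n - 1"
    and eq: "E = \<bar>det Q\<bar> + int n - 1 \<Longrightarrow> same_form n Q (Delta_form n \<bar>det Q\<bar>)"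
  shows "classes_bounded n Q"
  unfolding classes_bounded_def
proof
  fix x\<^sub>0 :: "int vec" assume x0: "x\<^sub>0 \<in> carrier_vec n"
  let ?x = "vec n (\<lambda>i. x\<^sub>0 $ i mod 2)"
  have "x\<^sub>0 - ?x = 2 \<cdot>\<^sub>v vec n (\<lambda>i. x\<^sub>0 $ i div 2)"
    using x0 by (intro eq_vecI) (auto simp: minus_mod_eq_mult_div)
  then have "vec_cong_mod2 n x\<^sub>0 ?x" unfolding vec_cong_mod2_def by auto
  moreover have "form_val Q ?x ?x \<ge> - E" by (rule val) auto
  ultimately show "\<exists>x\<in>carrier_vec n. vec_cong_mod2 n x\<^sub>0 x
        \<and> form_val Q x x + int n \<ge> 1 - \<bar>det Q\<bar>
        \<and> (\<not> same_form n Q (Delta_form n \<bar>det Q\<bar>) \<longrightarrow> form_val Q x x + int n > 1 - \<bar>det Q\<bar>)"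
    using le eq by (intro bexI[of _ ?x]) fastforce+
qed

section \<open>Explicit matrices\<close>

definition mat2 :: "'a \<Rightarrow> 'a \<Rightarrow> 'a \<Rightarrow> 'a \<Rightarrow> 'a mat" where
  "mat2 a b c d = mat_of_rows_list 2 [[a, b], [c, d]]"

definition mat3 :: "'a \<Rightarrow> 'a \<Rightarrow> 'a \<Rightarrow> 'a \<Rightarrow> 'a \<Rightarrow> 'a \<Rightarrow> 'a \<Rightarrow> 'a \<Rightarrow> 'a \<Rightarrow> 'a mat" where
  "mat3 a b c d e f g h i = mat_of_rows_list 3 [[a, b, c], [d, e, f], [g, h, i]]"

lemma mat2_carrier [simp]: "mat2 a b c d \<in> carrier_mat 2 2"
  by (intro carrier_matI) (simp_all add: mat2_def mat_of_rows_list_def)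

lemma mat3_carrier [simp]: "mat3 a b c d e f g h i \<in> carrier_mat 3 3"
  by (intro carrier_matI) (simp_all add: mat3_def mat_of_rows_list_def)

lemma mat2_index [simp]:
  "mat2 a b c d $$ (0, 0) = a" "mat2 a b c d $$ (0, Suc 0) = b"
  "mat2 a b c d $$ (Suc 0, 0) = c" "mat2 a b c d $$ (Suc 0, Suc 0) = d"
  "dim_row (mat2 a b c d) = 2" "dim_col (mat2 a b c d) = 2"
  by (simp_all add: mat2_def mat_of_rows_list_def)

lemma mat3_index [simp]:
  "mat3 a b c d e f g h i $$ (0, 0) = a" "mat3 a b c d e f g h i $$ (0, Suc 0) = b"
  "mat3 a b c d e f g h i $$ (0, Suc (Suc 0)) = c" "mat3 a b c d e f g h i $$ (Suc 0, 0) = d"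
  "mat3 a b c d e f g h i $$ (Suc 0, Suc 0) = e" "mat3 a b c d e f g h i $$ (Suc 0, Suc (Suc 0)) = f"
  "mat3 a b c d e f g h i $$ (Suc (Suc 0), 0) = g" "mat3 a b c d e f g h i $$ (Suc (Suc 0), Suc 0) = h"
  "mat3 a b c d e f g h i $$ (Suc (Suc 0), Suc (Suc 0)) = i"
  "dim_row (mat3 a b c d e f g h i) = 3" "dim_col (mat3 a b c d e f g h i) = 3"
  by (simp_all add: mat3_def mat_of_rows_list_def)

lemma less_2_cases_Suc: "(i::nat) < 2 \<longleftrightarrow> i = 0 \<or> i = Suc 0" by auto
lemma less_3_cases_Suc: "(i::nat) < 3 \<longleftrightarrow> i = 0 \<or> i = Suc 0 \<or> i = Suc (Suc 0)" by auto
lemma interval_2: "{0..<2::nat} = {0, Suc 0}" by auto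
lemma interval_3: "{0..<3::nat} = {0, Suc 0, Suc (Suc 0)}" by auto

lemma mat2_eta: "Q \<in> carrier_mat 2 2 \<Longrightarrow> Q = mat2 (Q $$ (0,0)) (Q $$ (0,1)) (Q $$ (1,0)) (Q $$ (1,1))"
  by (intro eq_matI) (auto simp: less_2_cases_Suc)

lemma mat3_eta:
  "Q \<in> carrier_mat 3 3 \<Longrightarrow>
     Q = mat3 (Q $$ (0,0)) (Q $$ (0,1)) (Q $$ (0,2)) (Q $$ (1,0)) (Q $$ (1,1)) (Q $$ (1,2))
           (Q $$ (2,0)) (Q $$ (2,1)) (Q $$ (2,2))"
  by (intro eq_matI) (auto simp: less_3_cases_Suc numeral_2_eq_2)

lemma mat2_transpose [simp]: "transpose_mat (mat2 a b c d) = mat2 a c b d"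
  by (intro eq_matI) (auto simp: less_2_cases_Suc)

lemma mat3_transpose [simp]: "transpose_mat (mat3 a b c d e f g h i) = mat3 a d g b e h c f i"
  by (intro eq_matI) (auto simp: less_3_cases_Suc)

lemma mat2_mult [simp]:
  "mat2 a b c d * mat2 a' b' c' d' =
     mat2 (a * a' + b * c') (a * b' + b * d') (c * a' + d * c') (c * b' + d * d' :: 'a :: comm_ring_1)"
  by (intro eq_matI) (auto simp: less_2_cases_Suc scalar_prod_def interval_2)

lemma mat3_mult [simp]:
  "mat3 a b c d e f g h i * mat3 a' b' c' d' e' f' g' h' i' =
     mat3 (a * a' + b * d' + c * g') (a * b' + b * e' + c * h') (a * c' + b * f' + c * i')
          (d * a' + e * d' + f * g') (d * b' + e * e' + f * h') (d * c' + e * f' + f * i')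
          (g * a' + h * d' + i * g') (g * b' + h * e' + i * h') (g * c' + h * f' + i * i' :: 'a :: comm_ring_1)"
  by (intro eq_matI) (auto simp: less_3_cases_Suc scalar_prod_def interval_3 add.assoc)

lemma one_mat2: "1\<^sub>m 2 = mat2 1 0 0 1"
  by (intro eq_matI) (auto simp: less_2_cases_Suc)

lemma one_mat3: "1\<^sub>m 3 = mat3 1 0 0 0 1 0 0 0 1"
  by (intro eq_matI) (auto simp: less_3_cases_Suc)

lemma mat2_eq_iff [simp]:
  "mat2 a b c d = mat2 a' b' c' d' \<longleftrightarrow> a = a' \<and> b = b' \<and> c = c' \<and> d = d'"
  by (metis mat2_index)

lemma mat3_eq_iff [simp]:
  "mat3 a b c d e f g h i = mat3 a' b' c' d' e' f' g' h' i' \<longleftrightarrow>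
     a = a' \<and> b = b' \<and> c = c' \<and> d = d' \<and> e = e' \<and> f = f' \<and> g = g' \<and> h = h' \<and> i = i'"
  by (metis mat3_index)

lemma form_val_mat2:
  fixes x y :: "'a :: comm_ring_1 vec"
  assumes "x \<in> carrier_vec 2" "y \<in> carrier_vec 2"
  shows "form_val (mat2 a b c d) x y =
           x $ 0 * (a * y $ 0 + b * y $ 1) + x $ 1 * (c * y $ 0 + d * y $ 1)"
  using assms unfolding form_val_def
  by (simp add: scalar_prod_def interval_2)

lemma form_val_mat3:
  fixes x y :: "'a :: comm_ring_1 vec"
  assumes "x \<in> carrier_vec 3" "y \<in> carrier_vec 3"
  shows "form_val (mat3 a b c d e f g h i) x y =
           x $ 0 * (a * y $ 0 + b * y $ 1 + c * y $ 2) + x $ 1 * (d * y $ 0 + e * y $ 1 + f * y $ 2)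
         + x $ 2 * (g * y $ 0 + h * y $ 1 + i * y $ 2)"
  using assms unfolding form_val_def
  by (simp add: scalar_prod_def interval_3 numeral_2_eq_2 add.assoc)

lemma det_mat2: "det (mat2 a b c d) = a * d - b * (c :: 'a :: comm_ring_1)"
proof -
  have "det (mat_delete (mat2 a b c d) 0 0) = d" "det (mat_delete (mat2 a b c d) 0 (Suc 0)) = c"
    by (subst det_single; simp add: mat_delete_def)+
  moreover have "{..<2::nat} = {0, Suc 0}" by auto
  ultimately show ?thesis
    by (subst laplace_expansion_row[of _ 2 0]) (simp_all add: cofactor_def)
qed

lemma det_mat3:
  "det (mat3 a b c d e f g h i) =
     a * (e * i - f * h) - b * (d * i - f * g) + c * (d * h - e * (g :: 'a :: comm_ring_1))"
proof -
  have "mat_delete (mat3 a b c d e f g h i) 0 0 = mat2 e f h i"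
    "mat_delete (mat3 a b c d e f g h i) 0 (Suc 0) = mat2 d f g i"
    "mat_delete (mat3 a b c d e f g h i) 0 (Suc (Suc 0)) = mat2 d e g h"
    by (intro eq_matI; auto simp: mat_delete_def less_2_cases_Suc)+
  moreover have "{..<3::nat} = {0, Suc 0, Suc (Suc 0)}" by auto
  ultimately show ?thesis
    by (subst laplace_expansion_row[of _ 3 0]) (simp_all add: cofactor_def det_mat2 algebra_simps)
qed

lemma Delta_form_1: "Delta_form 1 d = mat 1 1 (\<lambda>_. - d)"
  unfolding Delta_form_def by (intro eq_matI) (simp_all add: rank_one_def Let_def)

lemma Delta_form_2: "Delta_form 2 d = mat2 (-1) 0 0 (-d)"
  unfolding Delta_form_def
  by (intro eq_matI) (auto simp: rank_one_def Let_def less_2_cases_Suc)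

lemma Delta_form_3: "Delta_form 3 d = mat3 (-1) 0 0 0 (-1) 0 0 0 (-d)"
  unfolding Delta_form_def
  by (intro eq_matI) (auto simp: rank_one_def Let_def less_3_cases_Suc numeral_2_eq_2)


section \<open>Binary forms\<close>

text \<open>The matrix of a form with superbase \<open>v\<^sub>0 + v\<^sub>1 + v\<^sub>2 = 0\<close> in the basis \<open>v\<^sub>1, v\<^sub>2\<close>, where
  \<open>p = Q(v\<^sub>0, v\<^sub>1)\<close>, \<open>q = Q(v\<^sub>0, v\<^sub>2)\<close>, \<open>r = Q(v\<^sub>1, v\<^sub>2)\<close>; it is minus the reduced Laplacian of a triangle with
  weights \<open>p, q, r\<close>.\<close>

definition selling2 :: "int \<Rightarrow> int \<Rightarrow> int \<Rightarrow> int mat" where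
  "selling2 p q r = mat2 (- (p + r)) r r (- (q + r))"

lemma selling2_carrier [simp]: "selling2 p q r \<in> carrier_mat 2 2"
  by (simp add: selling2_def)

lemma integral_form_2_selling:
  assumes "integral_form 2 Q"
  obtains p q r where "Q = selling2 p q r"
proof -
  have Q: "Q \<in> carrier_mat 2 2" and sym: "transpose_mat Q = Q"
    using assms unfolding integral_form_def by simp_all
  have "Q $$ (1, 0) = Q $$ (0, 1)"
    by (subst sym[symmetric]) (use Q in simp)
  then have "Q = selling2 (- Q $$ (0,0) - Q $$ (0,1)) (- Q $$ (1,1) - Q $$ (0,1)) (Q $$ (0,1))"
    using mat2_eta[OF Q] unfolding selling2_def by simp
  then show ?thesis using that by blast
qed

lemma form_val_selling2:
  assumes "x \<in> carrier_vec 2"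
  shows "form_val (selling2 p q r) x x = - (p * (x $ 0)\<^sup>2 + q * (x $ 1)\<^sup>2 + r * (x $ 0 - x $ 1)\<^sup>2)"
  unfolding selling2_def form_val_mat2[OF assms assms] by (simp add: power2_eq_square algebra_simps)

lemma det_selling2: "det (selling2 p q r) = p * q + p * r + q * r"
  unfolding selling2_def det_mat2 by (simp add: algebra_simps)

text \<open>Transposing two members of the superbase permutes the weights. For \<open>v\<^sub>0\<close> and \<open>v\<^sub>1\<close> the first
  basis vector becomes \<open>-v\<^sub>1 - v\<^sub>2\<close>.\<close>

lemma selling2_swap12: "same_form 2 (selling2 q p r) (selling2 p q r)"
  by (rule same_formI[of "mat2 0 1 1 0" _ "mat2 0 1 1 0"])
    (simp_all add: selling2_def one_mat2 algebra_simps)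

lemma selling2_swap01: "same_form 2 (selling2 p r q) (selling2 p q r)"
  by (rule same_formI[of "mat2 (-1) 0 (-1) 1" _ "mat2 (-1) 0 (-1) 1"])
    (simp_all add: selling2_def one_mat2 algebra_simps)

text \<open>Selling's step passes to the superbase \<open>-v\<^sub>0, v\<^sub>1, v\<^sub>0 - v\<^sub>1\<close>. The total weight changes by
  \<open>2 p\<close>, so it decreases when \<open>p\<close> is negative.\<close>

lemma selling2_step: "same_form 2 (selling2 (- p) (2 * p + q) (2 * p + r)) (selling2 p q r)"
  by (rule same_formI[of "mat2 1 (-2) 0 (-1)" _ "mat2 1 (-2) 0 (-1)"])
    (simp_all add: selling2_def one_mat2 algebra_simps)

definition selling_minimal2 :: "int mat \<Rightarrow> int \<Rightarrow> int \<Rightarrow> int \<Rightarrow> bool" where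
  "selling_minimal2 Q p q r \<longleftrightarrow> same_form 2 Q (selling2 p q r) \<and>
     (\<forall>p' q' r'. same_form 2 Q (selling2 p' q' r') \<longrightarrow> p + q + r \<le> p' + q' + r')"

lemma selling_minimal2_swap12: "selling_minimal2 Q p q r \<Longrightarrow> selling_minimal2 Q q p r"
  unfolding selling_minimal2_def
  using same_form_trans[OF _ selling2_swap12[of p q r]] by (simp add: add.commute)

lemma selling_minimal2_swap01: "selling_minimal2 Q p q r \<Longrightarrow> selling_minimal2 Q p r q"
  unfolding selling_minimal2_def
  using same_form_trans[OF _ selling2_swap01[of p q r]] by (simp add: ac_simps)

lemma selling_minimal2_nonneg: "selling_minimal2 Q p q r \<Longrightarrow> p \<ge> 0"
proof -
  assume m: "selling_minimal2 Q p q r"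
  then have "same_form 2 Q (selling2 (- p) (2 * p + q) (2 * p + r))"
    using same_form_trans[OF _ same_form_sym[OF selling2_step]] unfolding selling_minimal2_def
    by simp
  then have "p + q + r \<le> - p + (2 * p + q) + (2 * p + r)"
    using m unfolding selling_minimal2_def by blast
  then show ?thesis by simp
qed

text \<open>The total weight is \<open>-(Q(v\<^sub>0, v\<^sub>0) + Q(v\<^sub>1, v\<^sub>1) + Q(v\<^sub>2, v\<^sub>2)) / 2\<close>. Positivity makes a superbase of least total weight exist.\<close>

lemma negative_definite_selling2_pos:
  assumes "negative_definite 2 (selling2 p q r)"
  shows "p + q + r > 0"
proof -
  have "form_val (selling2 p q r) x x < 0" if "x \<in> carrier_vec 2" "x $ 0 \<noteq> 0 \<or> x $ 1 \<noteq> 0" for x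
    using assms that unfolding negative_definite_def by fastforce
  note neg = this[unfolded form_val_selling2]
  have "p + r > 0" "q + r > 0" "p + q > 0"
    using neg[of "vec 2 (\<lambda>i. if i = 0 then 1 else 0)"] neg[of "vec 2 (\<lambda>i. if i = 0 then 0 else 1)"]
      neg[of "vec 2 (\<lambda>i. 1)"]
    by (simp_all add: form_val_selling2)
  then show ?thesis by linarith
qed

lemma binary_obtuse_superbase:
  assumes "integral_form 2 Q" "negative_definite 2 Q"
  obtains p q r where "same_form 2 Q (selling2 p q r)" "p \<ge> 0" "q \<ge> 0" "r \<ge> 0"
proof -
  define good where "good = (\<lambda>(p, q, r). same_form 2 Q (selling2 p q r))"
  define size where "size = (\<lambda>(p :: int, q, r). nat (p + q + r))"
  obtain p0 q0 r0 where "Q = selling2 p0 q0 r0" using integral_form_2_selling[OF assms(1)] .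
  then have "good (p0, q0, r0)" unfolding good_def by (simp add: same_form_refl)
  then obtain t where t: "good t" "\<And>t'. good t' \<Longrightarrow> size t \<le> size t'"
    using ex_has_least_nat[of good "(p0, q0, r0)" size] by blast
  obtain p q r where pqr: "t = (p, q, r)" by (cases t)
  have pos: "p' + q' + r' > 0" if "same_form 2 Q (selling2 p' q' r')" for p' q' r'
    using assms(1) same_form_negative_definite[OF same_form_sym[OF that] _ assms(2)]
    by (intro negative_definite_selling2_pos) (simp add: integral_form_def)
  have m: "selling_minimal2 Q p q r"
    unfolding selling_minimal2_def
  proof (intro conjI allI impI)
    show "same_form 2 Q (selling2 p q r)" using t(1) unfolding pqr good_def by simp
    fix p' q' r' assume "same_form 2 Q (selling2 p' q' r')"
    then show "p + q + r \<le> p' + q' + r'"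
      using t(2)[of "(p', q', r')"] pos[of p' q' r'] unfolding pqr good_def size_def by simp
  qed
  have "p \<ge> 0" "q \<ge> 0" "r \<ge> 0"
    using selling_minimal2_nonneg m selling_minimal2_swap12[OF m]
      selling_minimal2_swap12[OF selling_minimal2_swap01[OF m]] by blast+
  then show ?thesis using that m unfolding selling_minimal2_def by blast
qed

text \<open>The tree consists of the edges \<open>p\<close> and \<open>q\<close>. An edge counted by \<open>r\<close> can be exchanged for either of
  the two, which is why \<open>r\<close> must vanish in the case of equality; the defect is at least \<open>(p - 1) (q - 1) + r\<close>.\<close>

lemma selling2_star_bounded:
  assumes "p > 0" "q > 0" "r \<ge> 0"
  shows "classes_bounded 2 (selling2 p q r)"
proof (rule classes_boundedI)
  have "p * r \<ge> r" "q * r \<ge> r" using assms by (simp_all add: mult_le_cancel_right1)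
  moreover have "(p - 1) * (q - 1) \<ge> 0" using assms by simp
  moreover have det: "\<bar>det (selling2 p q r)\<bar> = p * q + p * r + q * r"
    using assms unfolding det_selling2 by simp
  ultimately have gap: "\<bar>det (selling2 p q r)\<bar> + int 2 - 1 - (p + q + r) \<ge> (p - 1) * (q - 1) + r"
    by (simp add: algebra_simps)
  with assms \<open>(p - 1) * (q - 1) \<ge> 0\<close> show "p + q + r \<le> \<bar>det (selling2 p q r)\<bar> + int 2 - 1" by linarith
  show "same_form 2 (selling2 p q r) (Delta_form 2 \<bar>det (selling2 p q r)\<bar>)"
    if "p + q + r = \<bar>det (selling2 p q r)\<bar> + int 2 - 1"
  proof -
    have "(p - 1) * (q - 1) = 0" "r = 0"
      using gap that assms \<open>(p - 1) * (q - 1) \<ge> 0\<close> by linarith+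
    then consider "p = 1" "r = 0" | "q = 1" "r = 0" by auto
    then show ?thesis
    proof cases
      case 1
      then show ?thesis using same_form_refl[of "selling2 p q r" 2] det
        by (simp add: Delta_form_2) (simp add: selling2_def)
    next
      case 2
      then show ?thesis using selling2_swap12[of p q r] det assms
        by (simp add: Delta_form_2) (simp add: selling2_def)
    qed
  qed
  fix x :: "int vec" assume x: "x \<in> carrier_vec 2" and "\<And>i. i < 2 \<Longrightarrow> x $ i \<in> {0, 1}"
  then have "x $ 0 \<in> {0, 1}" "x $ 1 \<in> {0, 1}" by auto
  then show "form_val (selling2 p q r) x x \<ge> - (p + q + r)"
    unfolding form_val_selling2[OF x] using assms by auto
qed

lemma binary_classes_bounded:
  assumes "integral_form 2 Q" "negative_definite 2 Q"
  shows "classes_bounded 2 Q"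
proof -
  obtain p q r where eq: "same_form 2 Q (selling2 p q r)" and nn: "p \<ge> 0" "q \<ge> 0" "r \<ge> 0"
    using binary_obtuse_superbase[OF assms] .
  have Q: "Q \<in> carrier_mat 2 2" using assms(1) unfolding integral_form_def by simp
  have "det (selling2 p q r) \<noteq> 0"
    using same_form_det[OF eq] negative_definite_det_nonzero[OF Q assms(2)] by simp
  then have "p * q \<noteq> 0 \<or> p * r \<noteq> 0 \<or> q * r \<noteq> 0" unfolding det_selling2 by auto
  then consider "p > 0" "q > 0" | "p > 0" "r > 0" | "q > 0" "r > 0" using nn by fastforce
  then have "classes_bounded 2 (selling2 p q r)"
  proof cases
    case 1
    then show ?thesis using selling2_star_bounded nn by simp
  next
    case 2
    then show ?thesis
      using classes_bounded_same_form[OF _ selling2_swap01] selling2_star_bounded[of p r q] nn by simp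
  next
    case 3
    then have "classes_bounded 2 (selling2 q p r)"
      using classes_bounded_same_form[OF _ selling2_swap01] selling2_star_bounded[of q r p] nn by simp
    then show ?thesis
      using classes_bounded_same_form[OF _ selling2_swap12] by simp
  qed
  then show ?thesis using classes_bounded_same_form[OF _ eq] by simp
qed

section \<open>Ternary forms\<close>

text \<open>The matrix of a form with superbase \<open>v\<^sub>0 + v\<^sub>1 + v\<^sub>2 + v\<^sub>3 = 0\<close> in the basis \<open>v\<^sub>1, v\<^sub>2, v\<^sub>3\<close>. The
  weights are listed in lexicographic order of the pairs:
  \<open>a = p\<^sub>0\<^sub>1\<close>, \<open>b = p\<^sub>0\<^sub>2\<close>, \<open>c = p\<^sub>0\<^sub>3\<close>, \<open>d = p\<^sub>1\<^sub>2\<close>, \<open>e = p\<^sub>1\<^sub>3\<close>, \<open>f = p\<^sub>2\<^sub>3\<close>.\<close>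

definition selling3 :: "int \<Rightarrow> int \<Rightarrow> int \<Rightarrow> int \<Rightarrow> int \<Rightarrow> int \<Rightarrow> int mat" where
  "selling3 a b c d e f = mat3 (- (a + d + e)) d e  d (- (b + d + f)) f  e f (- (c + e + f))"

text \<open>The sum over the 16 spanning trees of the complete graph on four vertices: all triples of edges except the
  four triangles \<open>a b d\<close>, \<open>a c e\<close>, \<open>b c f\<close>, \<open>d e f\<close>.\<close>

definition spanning_trees4 :: "int \<Rightarrow> int \<Rightarrow> int \<Rightarrow> int \<Rightarrow> int \<Rightarrow> int \<Rightarrow> int" where
  "spanning_trees4 a b c d e f =
     a*b*c + a*b*e + a*b*f + a*c*d + a*c*f + a*d*e + a*d*f + a*e*f
     + b*c*d + b*c*e + b*d*e + b*d*f + b*e*f + c*d*e + c*d*f + c*e*f"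

lemma selling3_carrier [simp]: "selling3 a b c d e f \<in> carrier_mat 3 3"
  by (simp add: selling3_def)

lemma integral_form_3_selling:
  assumes "integral_form 3 Q"
  obtains a b c d e f where "Q = selling3 a b c d e f"
proof -
  have Q: "Q \<in> carrier_mat 3 3" and sym: "transpose_mat Q = Q"
    using assms unfolding integral_form_def by simp_all
  have "Q $$ (i, j) = Q $$ (j, i)" if "i < 3" "j < 3" for i j
    by (subst sym[symmetric]) (use Q that in simp)
  then have "Q $$ (1, 0) = Q $$ (0, 1)" "Q $$ (2, 0) = Q $$ (0, 2)" "Q $$ (2, 1) = Q $$ (1, 2)"
    by simp_all
  then have "Q = selling3 (- Q $$ (0,0) - Q $$ (0,1) - Q $$ (0,2)) (- Q $$ (1,1) - Q $$ (0,1) - Q $$ (1,2))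
      (- Q $$ (2,2) - Q $$ (0,2) - Q $$ (1,2)) (Q $$ (0,1)) (Q $$ (0,2)) (Q $$ (1,2))"
    using mat3_eta[OF Q] unfolding selling3_def by simp
  then show ?thesis using that by blast
qed

lemma form_val_selling3:
  assumes "x \<in> carrier_vec 3"
  shows "form_val (selling3 a b c d e f) x x =
    - (a * (x $ 0)\<^sup>2 + b * (x $ 1)\<^sup>2 + c * (x $ 2)\<^sup>2
       + d * (x $ 0 - x $ 1)\<^sup>2 + e * (x $ 0 - x $ 2)\<^sup>2 + f * (x $ 1 - x $ 2)\<^sup>2)"
  unfolding selling3_def form_val_mat3[OF assms assms] by (simp add: power2_eq_square algebra_simps)

lemma det_selling3: "det (selling3 a b c d e f) = - spanning_trees4 a b c d e f"
  unfolding selling3_def det_mat3 spanning_trees4_def by (simp add: algebra_simps)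

text \<open>These three transpositions generate all permutations of the superbase; arguments that are
  symmetric in the four vertices are carried out up to these moves.\<close>

lemma selling3_swap01: "same_form 3 (selling3 a d e b c f) (selling3 a b c d e f)"
  by (rule same_formI[of "mat3 (-1) 0 0 (-1) 1 0 (-1) 0 1" _ "mat3 (-1) 0 0 (-1) 1 0 (-1) 0 1"])
    (simp_all add: selling3_def one_mat3 algebra_simps)

lemma selling3_swap12: "same_form 3 (selling3 b a c d f e) (selling3 a b c d e f)"
  by (rule same_formI[of "mat3 0 1 0 1 0 0 0 0 1" _ "mat3 0 1 0 1 0 0 0 0 1"])
    (simp_all add: selling3_def one_mat3 algebra_simps)

lemma selling3_swap23: "same_form 3 (selling3 a c b e d f) (selling3 a b c d e f)"
  by (rule same_formI[of "mat3 1 0 0 0 0 1 0 1 0" _ "mat3 1 0 0 0 0 1 0 1 0"])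
    (simp_all add: selling3_def one_mat3 algebra_simps)

text \<open>Selling's step for \<open>v\<^sub>0\<close> and \<open>v\<^sub>1\<close> passes to the superbase \<open>-v\<^sub>0, v\<^sub>1, v\<^sub>2 + v\<^sub>0, v\<^sub>3 + v\<^sub>0\<close>. The total
  weight changes by \<open>a\<close>, so it decreases when \<open>a\<close> is negative.\<close>

lemma selling3_step:
  "same_form 3 (selling3 (- a) (a + c) (a + b) (a + d) (a + e) (f - a)) (selling3 a b c d e f)"
  by (rule same_formI[of "mat3 1 (-1) (-1) 0 0 (-1) 0 (-1) 0" _ "mat3 1 (-1) (-1) 0 0 (-1) 0 (-1) 0"])
    (simp_all add: selling3_def one_mat3 algebra_simps)

text \<open>For the path \<open>v\<^sub>0, v\<^sub>1, v\<^sub>2, v\<^sub>3\<close> the form is \<open>-(a x\<^sub>1\<^sup>2 + d (x\<^sub>1 - x\<^sub>2)\<^sup>2 + f (x\<^sub>3 - x\<^sub>2)\<^sup>2)\<close>, and the differences along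
  the edges are coordinates in which it is diagonal.\<close>

lemma selling3_path: "same_form 3 (selling3 a 0 0 d 0 f) (selling3 a d f 0 0 0)"
  by (rule same_formI[of "mat3 1 0 0 1 (-1) 0 0 (-1) 1" _ "mat3 1 0 0 1 (-1) 0 1 (-1) 1"])
    (simp_all add: selling3_def one_mat3 algebra_simps)

definition selling_minimal3 :: "int mat \<Rightarrow> int \<Rightarrow> int \<Rightarrow> int \<Rightarrow> int \<Rightarrow> int \<Rightarrow> int \<Rightarrow> bool" where
  "selling_minimal3 Q a b c d e f \<longleftrightarrow> same_form 3 Q (selling3 a b c d e f) \<and>
     (\<forall>a' b' c' d' e' f'. same_form 3 Q (selling3 a' b' c' d' e' f') \<longrightarrow>
        a + b + c + d + e + f \<le> a' + b' + c' + d' + e' + f')"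

lemma selling_minimal3_swap01: "selling_minimal3 Q a b c d e f \<Longrightarrow> selling_minimal3 Q a d e b c f"
  unfolding selling_minimal3_def
  using same_form_trans[OF _ same_form_sym[OF selling3_swap01[of a d e b c f]]] by (simp add: ac_simps)

lemma selling_minimal3_swap12: "selling_minimal3 Q a b c d e f \<Longrightarrow> selling_minimal3 Q b a c d f e"
  unfolding selling_minimal3_def
  using same_form_trans[OF _ same_form_sym[OF selling3_swap12[of b a c d f e]]] by (simp add: ac_simps)

lemma selling_minimal3_swap23: "selling_minimal3 Q a b c d e f \<Longrightarrow> selling_minimal3 Q a c b e d f"
  unfolding selling_minimal3_def
  using same_form_trans[OF _ same_form_sym[OF selling3_swap23[of a c b e d f]]] by (simp add: ac_simps)

lemma selling_minimal3_nonneg: "selling_minimal3 Q a b c d e f \<Longrightarrow> a \<ge> 0"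
proof -
  assume m: "selling_minimal3 Q a b c d e f"
  then have "same_form 3 Q (selling3 (- a) (a + c) (a + b) (a + d) (a + e) (f - a))"
    using same_form_trans[OF _ same_form_sym[OF selling3_step]] unfolding selling_minimal3_def
    by simp
  then have "a + b + c + d + e + f \<le> - a + (a + c) + (a + b) + (a + d) + (a + e) + (f - a)"
    using m unfolding selling_minimal3_def by blast
  then show ?thesis by simp
qed

lemma negative_definite_selling3_pos:
  assumes "negative_definite 3 (selling3 a b c d e f)"
  shows "a + b + c + d + e + f > 0"
proof -
  have "form_val (selling3 a b c d e f) x x < 0"
    if "x \<in> carrier_vec 3" "x $ 0 \<noteq> 0 \<or> x $ 1 \<noteq> 0 \<or> x $ 2 \<noteq> 0" for x
    using assms that unfolding negative_definite_def by fastforce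
  note neg = this[unfolded form_val_selling3]
  have "a + d + e > 0" "b + d + f > 0" "c + e + f > 0" "a + b + c > 0"
    using neg[of "vec 3 (\<lambda>i. if i = 0 then 1 else 0)"] neg[of "vec 3 (\<lambda>i. if i = 1 then 1 else 0)"]
      neg[of "vec 3 (\<lambda>i. if i = 2 then 1 else 0)"] neg[of "vec 3 (\<lambda>i. 1)"]
    by (simp_all add: form_val_selling3)
  then show ?thesis by linarith
qed

text \<open>When the total weight is minimal, \<open>a\<close> is nonnegative, because Selling's step cannot decrease the total weight any
  further; each of the other weights can be moved to the place of \<open>a\<close> by transpositions.\<close>

lemma ternary_obtuse_superbase:
  assumes "integral_form 3 Q" "negative_definite 3 Q"
  obtains a b c d e f where "same_form 3 Q (selling3 a b c d e f)"
    "a \<ge> 0" "b \<ge> 0" "c \<ge> 0" "d \<ge> 0" "e \<ge> 0" "f \<ge> 0"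
proof -
  define good where "good = (\<lambda>(a, b, c, d, e, f). same_form 3 Q (selling3 a b c d e f))"
  define size where "size = (\<lambda>(a :: int, b, c, d, e, f). nat (a + b + c + d + e + f))"
  obtain a0 b0 c0 d0 e0 f0 where "Q = selling3 a0 b0 c0 d0 e0 f0"
    using integral_form_3_selling[OF assms(1)] .
  then have "good (a0, b0, c0, d0, e0, f0)" unfolding good_def by (simp add: same_form_refl)
  then obtain t where t: "good t" "\<And>t'. good t' \<Longrightarrow> size t \<le> size t'"
    using ex_has_least_nat[of good _ size] by blast
  obtain a b c d e f where t_eq: "t = (a, b, c, d, e, f)" by (cases t)
  have pos: "a' + b' + c' + d' + e' + f' > 0" if "same_form 3 Q (selling3 a' b' c' d' e' f')"
    for a' b' c' d' e' f'
    using assms(1) same_form_negative_definite[OF same_form_sym[OF that] _ assms(2)]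
    by (intro negative_definite_selling3_pos) (simp add: integral_form_def)
  have m: "selling_minimal3 Q a b c d e f"
    unfolding selling_minimal3_def
  proof (intro conjI allI impI)
    show "same_form 3 Q (selling3 a b c d e f)" using t(1) unfolding t_eq good_def by simp
    fix a' b' c' d' e' f' assume "same_form 3 Q (selling3 a' b' c' d' e' f')"
    then show "a + b + c + d + e + f \<le> a' + b' + c' + d' + e' + f'"
      using t(2)[of "(a', b', c', d', e', f')"] pos[of a' b' c' d' e' f']
      unfolding t_eq good_def size_def by simp
  qed
  note swaps = selling_minimal3_swap01 selling_minimal3_swap12 selling_minimal3_swap23
  have "a \<ge> 0" by (rule selling_minimal3_nonneg[OF m])
  moreover have m12: "selling_minimal3 Q b a c d f e" using m by (rule swaps)
  then have "b \<ge> 0" by (rule selling_minimal3_nonneg)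
  moreover have "selling_minimal3 Q c a b e f d" using swaps(2)[OF swaps(3)[OF m]] .
  then have "c \<ge> 0" by (rule selling_minimal3_nonneg)
  moreover have "selling_minimal3 Q d a e b f c" using swaps(2)[OF swaps(1)[OF m]] .
  then have "d \<ge> 0" by (rule selling_minimal3_nonneg)
  moreover have "selling_minimal3 Q e a d c f b" using swaps(2)[OF swaps(3)[OF swaps(1)[OF m]]] .
  then have "e \<ge> 0" by (rule selling_minimal3_nonneg)
  moreover have "selling_minimal3 Q f b d c e a"
    using swaps(2)[OF swaps(3)[OF swaps(1)[OF m12]]] .
  then have "f \<ge> 0" by (rule selling_minimal3_nonneg)
  ultimately show ?thesis using that m unfolding selling_minimal3_def by blast
qed

text \<open>The weights of a star are the negated diagonal entries, so the star with weights \<open>1, 1, \<delta>\<close> is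
  \<open>\<Delta>\<^sub>\<delta>\<close> itself.\<close>

lemma diagonal_selling3_Delta:
  assumes "x = 1 \<and> y = 1 \<or> x = 1 \<and> z = 1 \<or> y = 1 \<and> z = 1"
  shows "same_form 3 (selling3 x y z 0 0 0) (Delta_form 3 (x * y * z))"
proof -
  have Delta: "Delta_form 3 d = selling3 1 1 d 0 0 0" for d
    by (simp add: Delta_form_3 selling3_def)
  have "same_form 3 (selling3 1 d 1 0 0 0) (selling3 1 1 d 0 0 0)" for d
    by (rule selling3_swap23)
  moreover from this have "same_form 3 (selling3 d 1 1 0 0 0) (selling3 1 1 d 0 0 0)" for d
    by (rule same_form_trans[OF selling3_swap12]) simp
  ultimately show ?thesis
    using assms by (auto simp: Delta same_form_refl)
qed

text \<open>The arithmetic common to all spanning trees on four vertices: \<open>x, y, z\<close> are the multiplicities of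
  the edges of a tree and \<open>s\<close> counts the edges outside it. There are \<open>x y z\<close> spanning trees with the same
  underlying simple tree, and every outside edge closes a cycle through at least two edges of the
  tree, which accounts for \<open>2 s\<close> more.\<close>

lemma tree_excess:
  fixes x y z s T :: int
  assumes "x > 0" "y > 0" "z > 0" "s \<ge> 0" "T \<ge> x * y * z + 2 * s"
  shows "x + y + z + s \<le> T + 2"
    and "x + y + z + s = T + 2 \<Longrightarrow>
      s = 0 \<and> T = x * y * z \<and> (x = 1 \<and> y = 1 \<or> x = 1 \<and> z = 1 \<or> y = 1 \<and> z = 1)"
proof -
  have nn: "(x - 1) * (y - 1) * z \<ge> 0" "(z - 1) * (x + y - 2) \<ge> 0"
    using assms by simp_all
  have id: "x * y * z - x - y - z + 2 = (x - 1) * (y - 1) * z + (z - 1) * (x + y - 2)"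
    by (simp add: algebra_simps)
  show "x + y + z + s \<le> T + 2" using nn id assms by linarith
  assume "x + y + z + s = T + 2"
  then have "s = 0" "T = x * y * z" "(x - 1) * (y - 1) * z = 0" "(z - 1) * (x + y - 2) = 0"
    using nn id assms by linarith+
  then show "s = 0 \<and> T = x * y * z \<and> (x = 1 \<and> y = 1 \<or> x = 1 \<and> z = 1 \<or> y = 1 \<and> z = 1)"
    using assms by auto
qed

lemma selling3_unit_cube:
  assumes "a \<ge> 0" "b \<ge> 0" "c \<ge> 0" "d \<ge> 0" "e \<ge> 0" "f \<ge> 0"
    and x: "x \<in> carrier_vec 3" and "\<And>i. i < 3 \<Longrightarrow> x $ i \<in> {0, 1}"
  shows "form_val (selling3 a b c d e f) x x \<ge> - (a + b + c + d + e + f)"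
proof -
  have "x $ 0 \<in> {0, 1}" "x $ 1 \<in> {0, 1}" "x $ 2 \<in> {0, 1}" using assms(8) by auto
  then show ?thesis
    unfolding form_val_selling3[OF x] using assms(1-6) by auto
qed

lemma spanning_trees4_nonneg:
  "a \<ge> 0 \<Longrightarrow> b \<ge> 0 \<Longrightarrow> c \<ge> 0 \<Longrightarrow> d \<ge> 0 \<Longrightarrow> e \<ge> 0 \<Longrightarrow> f \<ge> 0 \<Longrightarrow> spanning_trees4 a b c d e f \<ge> 0"
  unfolding spanning_trees4_def by simp

lemma mult_pos_ge_int: "(k::int) \<ge> 0 \<Longrightarrow> u > 0 \<Longrightarrow> v > 0 \<Longrightarrow> u * v * k \<ge> k"
  using mult_right_mono[of 1 "u * v" k] mult_pos_pos[of u v] by linarith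

text \<open>The tree is the star at \<open>v\<^sub>0\<close>. The grouping of the spanning trees exhibits, for each of \<open>d, e, f\<close>,
  the two exchanges into this star.\<close>

lemma selling3_star_bounded:
  assumes "a > 0" "b > 0" "c > 0" "d \<ge> 0" "e \<ge> 0" "f \<ge> 0"
  shows "classes_bounded 3 (selling3 a b c d e f)"
proof -
  let ?T = "spanning_trees4 a b c d e f"
  have det: "\<bar>det (selling3 a b c d e f)\<bar> = ?T"
    unfolding det_selling3 using spanning_trees4_nonneg[of a b c d e f] assms by simp
  have "a*b*c + (d + d) + (e + e) + (f + f) + 0
      \<le> a*b*c + (a*c*d + b*c*d) + (a*b*e + b*c*e) + (a*b*f + a*c*f)
        + (a*d*e + a*d*f + a*e*f + b*d*e + b*d*f + b*e*f + c*d*e + c*d*f + c*e*f)"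
    by (intro add_mono order_refl mult_pos_ge_int add_nonneg_nonneg mult_nonneg_nonneg)
      (use assms in simp_all)
  then have "?T \<ge> a * b * c + 2 * (d + e + f)" unfolding spanning_trees4_def by simp
  note excess = tree_excess[OF assms(1-3) _ this]
  show ?thesis
  proof (rule classes_boundedI)
    show "form_val (selling3 a b c d e f) x x \<ge> - (a + b + c + d + e + f)"
      if "x \<in> carrier_vec 3" "\<And>i. i < 3 \<Longrightarrow> x $ i \<in> {0, 1}" for x
      using selling3_unit_cube[OF _ _ _ assms(4-6) that] assms(1-3) by simp
    show "a + b + c + d + e + f \<le> \<bar>det (selling3 a b c d e f)\<bar> + int 3 - 1"
      unfolding det using excess(1) assms by simp
    assume "a + b + c + d + e + f = \<bar>det (selling3 a b c d e f)\<bar> + int 3 - 1"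
    then have "d + e + f = 0" and T: "?T = a * b * c"
      and ones: "a = 1 \<and> b = 1 \<or> a = 1 \<and> c = 1 \<or> b = 1 \<and> c = 1"
      unfolding det using excess(2) assms by simp_all
    then have "d = 0" "e = 0" "f = 0" using assms by simp_all
    then show "same_form 3 (selling3 a b c d e f) (Delta_form 3 \<bar>det (selling3 a b c d e f)\<bar>)"
      unfolding det T using diagonal_selling3_Delta[OF ones] by simp
  qed
qed

text \<open>The tree is the path \<open>v\<^sub>0, v\<^sub>1, v\<^sub>2, v\<^sub>3\<close>. The edge \<open>c\<close> closes a cycle of length four and could be
  exchanged in three ways, of which two suffice.\<close>

lemma selling3_path_bounded:
  assumes "a > 0" "d > 0" "f > 0" "b \<ge> 0" "c \<ge> 0" "e \<ge> 0"
  shows "classes_bounded 3 (selling3 a b c d e f)"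
proof -
  let ?T = "spanning_trees4 a b c d e f"
  have det: "\<bar>det (selling3 a b c d e f)\<bar> = ?T"
    unfolding det_selling3 using spanning_trees4_nonneg[of a b c d e f] assms by simp
  have "a*d*f + (b + b) + (c + c) + (e + e) + 0
      \<le> a*d*f + (a*f*b + d*f*b) + (a*d*c + a*f*c) + (a*d*e + a*f*e)
        + (a*b*c + a*b*e + b*c*d + b*c*e + b*d*e + b*e*f + c*d*e + c*d*f + c*e*f)"
    by (intro add_mono order_refl mult_pos_ge_int add_nonneg_nonneg mult_nonneg_nonneg)
      (use assms in simp_all)
  then have "?T \<ge> a * d * f + 2 * (b + c + e)"
    unfolding spanning_trees4_def by (simp add: ac_simps)
  note excess = tree_excess[OF assms(1-3) _ this]
  show ?thesis
  proof (rule classes_boundedI)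
    show "form_val (selling3 a b c d e f) x x \<ge> - (a + b + c + d + e + f)"
      if "x \<in> carrier_vec 3" "\<And>i. i < 3 \<Longrightarrow> x $ i \<in> {0, 1}" for x
      using selling3_unit_cube[OF _ _ _ _ _ _ that] assms by simp
    show "a + b + c + d + e + f \<le> \<bar>det (selling3 a b c d e f)\<bar> + int 3 - 1"
      unfolding det using excess(1) assms by simp
    assume "a + b + c + d + e + f = \<bar>det (selling3 a b c d e f)\<bar> + int 3 - 1"
    then have "b + c + e = 0" and T: "?T = a * d * f"
      and ones: "a = 1 \<and> d = 1 \<or> a = 1 \<and> f = 1 \<or> d = 1 \<and> f = 1"
      unfolding det using excess(2) assms by simp_all
    then have "b = 0" "c = 0" "e = 0" using assms by simp_all
    then show "same_form 3 (selling3 a b c d e f) (Delta_form 3 \<bar>det (selling3 a b c d e f)\<bar>)"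
      unfolding det T
      using same_form_trans[OF selling3_path diagonal_selling3_Delta[OF ones]] Delta_form_carrier
      by simp
  qed
qed

lemma
  shows classes_bounded_swap01:
    "classes_bounded 3 (selling3 a d e b c f) \<Longrightarrow> classes_bounded 3 (selling3 a b c d e f)"
    and classes_bounded_swap12:
    "classes_bounded 3 (selling3 b a c d f e) \<Longrightarrow> classes_bounded 3 (selling3 a b c d e f)"
    and classes_bounded_swap23:
    "classes_bounded 3 (selling3 a c b e d f) \<Longrightarrow> classes_bounded 3 (selling3 a b c d e f)"
  by (rule classes_bounded_same_form[rotated]; (rule selling3_swap01 selling3_swap12 selling3_swap23)?; simp)+

text \<open>The connected set \<open>v\<^sub>0, v\<^sub>1, v\<^sub>2\<close> is extended by an edge at \<open>v\<^sub>3\<close>. The result is a path if this edge ends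
  in \<open>v\<^sub>2\<close> or in \<open>v\<^sub>0\<close>, and a star at \<open>v\<^sub>1\<close> if it ends there.\<close>

lemma selling3_two_edges_bounded:
  assumes nn: "a \<ge> 0" "b \<ge> 0" "c \<ge> 0" "d \<ge> 0" "e \<ge> 0" "f \<ge> 0"
    and "a > 0" "d > 0" and "c > 0 \<or> e > 0 \<or> f > 0"
  shows "classes_bounded 3 (selling3 a b c d e f)"
proof -
  consider "f > 0" | "e > 0" | "c > 0" using assms by blast
  then show ?thesis
  proof cases
    case 1
    then show ?thesis using selling3_path_bounded assms by simp
  next
    case 2
    then have "classes_bounded 3 (selling3 a d e b c f)"
      by (intro selling3_star_bounded) (use assms in simp_all)
    then show ?thesis by (rule classes_bounded_swap01)
  next
    case 3
    \<comment> \<open>The path \<open>v\<^sub>3, v\<^sub>0, v\<^sub>1, v\<^sub>2\<close>, read backwards, is made standard by exchanging \<open>v\<^sub>0\<close> and \<open>v\<^sub>2\<close>.\<close>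
    then have "classes_bounded 3 (selling3 d b f a e c)"
      by (intro selling3_path_bounded) (use assms in simp_all)
    then show ?thesis
      by (rule classes_bounded_swap01[OF classes_bounded_swap12[OF classes_bounded_swap01]])
  qed
qed

text \<open>The edge between \<open>v\<^sub>0\<close> and \<open>v\<^sub>1\<close> is extended by an edge to \<open>v\<^sub>2\<close> or \<open>v\<^sub>3\<close>. The hypotheses say that some
  edge leaves \<open>{v\<^sub>0, v\<^sub>1}\<close> and that \<open>v\<^sub>2\<close> and \<open>v\<^sub>3\<close> are not isolated; they are stable under the
  transpositions used to bring the second edge to the place of \<open>d\<close>.\<close>

lemma selling3_one_edge_bounded:
  assumes nn: "a \<ge> 0" "b \<ge> 0" "c \<ge> 0" "d \<ge> 0" "e \<ge> 0" "f \<ge> 0"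
    and "a > 0" and "b > 0 \<or> c > 0 \<or> d > 0 \<or> e > 0"
    and "b > 0 \<or> d > 0 \<or> f > 0" "c > 0 \<or> e > 0 \<or> f > 0"
  shows "classes_bounded 3 (selling3 a b c d e f)"
proof -
  consider "d > 0" | "b > 0" | "e > 0" | "c > 0" using assms by blast
  then show ?thesis
  proof cases
    case 1
    then show ?thesis using selling3_two_edges_bounded assms by simp
  next
    case 2
    then have "classes_bounded 3 (selling3 a d e b c f)"
      by (intro selling3_two_edges_bounded) (use assms in auto)
    then show ?thesis by (rule classes_bounded_swap01)
  next
    case 3
    then have "classes_bounded 3 (selling3 a c b e d f)"
      by (intro selling3_two_edges_bounded) (use assms in auto)
    then show ?thesis by (rule classes_bounded_swap23)
  next
    case 4
    then have "classes_bounded 3 (selling3 a e d c b f)"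
      by (intro selling3_two_edges_bounded) (use assms in auto)
    then show ?thesis by (rule classes_bounded_swap01[OF classes_bounded_swap23])
  qed
qed

text \<open>A graph with a spanning tree is connected, that is, an edge leaves every vertex and every pair of vertices.
  This is all that is needed to grow a tree from an edge at \<open>v\<^sub>0\<close>.\<close>

lemma selling3_bounded:
  assumes nn: "a \<ge> 0" "b \<ge> 0" "c \<ge> 0" "d \<ge> 0" "e \<ge> 0" "f \<ge> 0"
    and trees: "spanning_trees4 a b c d e f \<noteq> 0"
  shows "classes_bounded 3 (selling3 a b c d e f)"
proof -
  have pos_iff: "a > 0 \<longleftrightarrow> a \<noteq> 0" "b > 0 \<longleftrightarrow> b \<noteq> 0" "c > 0 \<longleftrightarrow> c \<noteq> 0"
    "d > 0 \<longleftrightarrow> d \<noteq> 0" "e > 0 \<longleftrightarrow> e \<noteq> 0" "f > 0 \<longleftrightarrow> f \<noteq> 0"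
    using nn by auto
  have vertices: "a > 0 \<or> b > 0 \<or> c > 0" "a > 0 \<or> d > 0 \<or> e > 0"
      "b > 0 \<or> d > 0 \<or> f > 0" "c > 0 \<or> e > 0 \<or> f > 0"
    and cuts: "b > 0 \<or> c > 0 \<or> d > 0 \<or> e > 0" "a > 0 \<or> c > 0 \<or> d > 0 \<or> f > 0"
      "a > 0 \<or> b > 0 \<or> e > 0 \<or> f > 0"
    unfolding pos_iff using trees unfolding spanning_trees4_def by auto
  consider "a > 0" | "b > 0" | "c > 0" using vertices by blast
  then show ?thesis
  proof cases
    case 1
    then show ?thesis by (intro selling3_one_edge_bounded nn vertices cuts)
  next
    case 2
    then have "classes_bounded 3 (selling3 b a c d f e)"
      by (intro selling3_one_edge_bounded) (use nn vertices cuts in auto)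
    then show ?thesis by (rule classes_bounded_swap12)
  next
    case 3
    then have "classes_bounded 3 (selling3 c a b e f d)"
      by (intro selling3_one_edge_bounded) (use nn vertices cuts in auto)
    then show ?thesis by (rule classes_bounded_swap23[OF classes_bounded_swap12])
  qed
qed

lemma ternary_classes_bounded:
  assumes "integral_form 3 Q" "negative_definite 3 Q"
  shows "classes_bounded 3 Q"
proof -
  obtain a b c d e f where eq: "same_form 3 Q (selling3 a b c d e f)"
    and nn: "a \<ge> 0" "b \<ge> 0" "c \<ge> 0" "d \<ge> 0" "e \<ge> 0" "f \<ge> 0"
    using ternary_obtuse_superbase[OF assms] .
  have Q: "Q \<in> carrier_mat 3 3" using assms(1) unfolding integral_form_def by simp
  have "det (selling3 a b c d e f) \<noteq> 0"
    using same_form_det[OF eq] negative_definite_det_nonzero[OF Q assms(2)] by simp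
  then have "classes_bounded 3 (selling3 a b c d e f)"
    using selling3_bounded[OF nn] unfolding det_selling3 by simp
  then show ?thesis using classes_bounded_same_form[OF _ eq] by simp
qed

section \<open>Unary forms and the dual of a binary form\<close>

lemma unary_classes_bounded:
  assumes "integral_form 1 Q" "negative_definite 1 Q"
  shows "classes_bounded 1 Q"
proof (rule classes_boundedI)
  let ?q = "Q $$ (0, 0)"
  have Q: "Q \<in> carrier_mat 1 1" using assms(1) unfolding integral_form_def by simp
  have val: "form_val Q x x = ?q * (x $ 0)\<^sup>2" if "x \<in> carrier_vec 1" for x
    using that Q unfolding form_val_def by (simp add: scalar_prod_def power2_eq_square algebra_simps)
  have "form_val Q (vec 1 (\<lambda>_. 1)) (vec 1 (\<lambda>_. 1)) < 0"
    using assms(2) unfolding negative_definite_def by (simp add: vec_eq_iff)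
  then have neg: "?q < 0" by (simp add: val)
  then have det: "\<bar>det Q\<bar> = - ?q" using det_single[OF Q] by simp
  then show "- ?q \<le> \<bar>det Q\<bar> + int 1 - 1" by simp
  have "Q = Delta_form 1 (- ?q)" unfolding Delta_form_1 using Q by (intro eq_matI) auto
  then show "same_form 1 Q (Delta_form 1 \<bar>det Q\<bar>)" unfolding det using same_form_refl[OF Q] by simp
  fix x :: "int vec" assume x: "x \<in> carrier_vec 1" and "\<And>i. i < 1 \<Longrightarrow> x $ i \<in> {0, 1}"
  then have "x $ 0 \<in> {0, 1}" by auto
  then show "form_val Q x x \<ge> - (- ?q)" unfolding val[OF x] using neg by auto
qed

text \<open>The inverse of \<open>Q\<close> is its adjugate divided by \<open>det Q\<close>, and the adjugate is \<open>J\<^sup>T Q J\<close> for the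
  rotation \<open>J\<close> with \<open>J y = (y\<^sub>1, -y\<^sub>0)\<close>.\<close>

lemma dual_form_val_binary:
  assumes Q: "Q = mat2 a b b c" and det: "det Q \<noteq> 0" and y: "y \<in> carrier_vec 2"
  shows "dual_form_val Q y y =
     of_int (form_val Q (vec_of_list [y $ 1, - (y $ 0)]) (vec_of_list [y $ 1, - (y $ 0)])) / of_int (det Q)"
proof -
  define D where "D = rat_of_int (det Q)"
  define M where "M = map_mat rat_of_int Q"
  define w where "w = map_vec rat_of_int y"
  define A where "A = mat2 (of_int c / D) (- of_int b / D) (- of_int b / D) (of_int a / D)"
  have D0: "D \<noteq> 0" using det by (simp add: D_def)
  have D: "D = of_int a * of_int c - of_int b * of_int b" by (simp add: D_def Q det_mat2)
  have M: "M = mat2 (of_int a) (of_int b) (of_int b) (of_int c)"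
    unfolding M_def Q by (intro eq_matI) (auto simp: less_2_cases_Suc)
  then have Mc: "M \<in> carrier_mat 2 2" by simp
  have MA: "M * A = 1\<^sub>m 2" "A * M = 1\<^sub>m 2"
    unfolding M A_def one_mat2 using D0 by (simp_all add: field_simps) (simp_all add: D algebra_simps)
  have "M \<in> Units (ring_mat TYPE(rat) 2 b)" for b
    unfolding Units_def using MA Mc by (auto simp: ring_mat_simps A_def)
  then obtain B where B: "mat_inverse M = Some B" using mat_inverse(1)[OF Mc] by fastforce
  then have B': "M * B = 1\<^sub>m 2" "B \<in> carrier_mat 2 2" using mat_inverse(2)[OF Mc] by simp_all
  have Ac: "A \<in> carrier_mat 2 2" by (simp add: A_def)
  \<comment> \<open>\<^const>\<open>mat_inverse\<close> is only known to return some inverse, which is unique.\<close>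
  have "B = (A * M) * B" using MA B' by simp
  also have "\<dots> = A * (M * B)" by (rule assoc_mult_mat[OF Ac Mc B'(2)])
  finally have "B = A" using B' Ac by simp
  then have "dual_form_val Q y y = form_val A w w"
    unfolding dual_form_val_def using B by (simp add: M_def w_def)
  also have "\<dots> = (of_int c * (w $ 0)\<^sup>2 - 2 * of_int b * w $ 0 * w $ 1 + of_int a * (w $ 1)\<^sup>2) / D"
    using y D0 unfolding A_def w_def
    by (subst form_val_mat2) (auto simp: field_simps power2_eq_square)
  also have "\<dots> = of_int (form_val Q (vec_of_list [y $ 1, - (y $ 0)]) (vec_of_list [y $ 1, - (y $ 0)])) / D"
    using y unfolding Q w_def
    by (subst form_val_mat2) (auto simp: field_simps power2_eq_square intro!: carrier_vecI)
  finally show ?thesis by (simp add: D_def)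
qed

text \<open>The value \<open>Q(\<xi>, \<xi>)\<close> is linear modulo 2, with the diagonal entries as coefficients, since
  \<open>\<xi>\<^sub>i\<^sup>2\<close> and \<open>\<xi>\<^sub>i\<close> have the same parity.\<close>

lemma characteristic_covector_binary:
  assumes y: "y \<in> carrier_vec 2" and "[y $ 0 = a] (mod 2)" "[y $ 1 = c] (mod 2)"
  shows "characteristic_covector 2 (mat2 a b b c) y"
  unfolding characteristic_covector_def
proof (intro conjI ballI y)
  fix \<xi> :: "int vec" assume \<xi>: "\<xi> \<in> carrier_vec 2"
  have "y \<bullet> \<xi> = y $ 0 * \<xi> $ 0 + y $ 1 * \<xi> $ 1"
    using \<xi> by (simp add: scalar_prod_def interval_2)
  moreover have "form_val (mat2 a b b c) \<xi> \<xi> = a * (\<xi> $ 0)\<^sup>2 + c * (\<xi> $ 1)\<^sup>2 + 2 * (b * \<xi> $ 0 * \<xi> $ 1)"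
    unfolding form_val_mat2[OF \<xi> \<xi>] by (simp add: power2_eq_square algebra_simps)
  moreover have "even (y $ 0) = even a" "even (y $ 1) = even c"
    using assms(2,3) unfolding cong_def by (auto simp: even_iff_mod_2_eq_zero)
  then have "even (y $ 0 * \<xi> $ 0 + y $ 1 * \<xi> $ 1) = even (a * (\<xi> $ 0)\<^sup>2 + c * (\<xi> $ 1)\<^sup>2 + 2 * (b * \<xi> $ 0 * \<xi> $ 1))"
    by auto
  ultimately show "[y \<bullet> \<xi> = form_val (mat2 a b b c) \<xi> \<xi>] (mod 2)"
    by (simp add: cong_iff_dvd_diff)
qed

text \<open>The covector has to be congruent to the diagonal \<open>(a, c)\<close>, so its rotation must lie in the class of
  \<open>(c, -a)\<close>. Division of the bound for that class by \<open>\<delta>\<close> is the claim.\<close>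

lemma binary_covector_bounded:
  assumes Q: "integral_form 2 Q" and neg: "negative_definite 2 Q"
  defines "\<delta> \<equiv> \<bar>det Q\<bar>"
  obtains y where "characteristic_covector 2 Q y"
    "dual_form_val Q y y + 2 \<ge> 1 - 1 / rat_of_int \<delta>"
    "\<not> same_form 2 Q (Delta_form 2 \<delta>) \<Longrightarrow> dual_form_val Q y y + 2 > 1 - 1 / rat_of_int \<delta>"
proof -
  obtain p q r where pqr: "Q = selling2 p q r" using integral_form_2_selling[OF Q] .
  define a b c where "a = - (p + r)" and "b = r" and "c = - (q + r)"
  have Qm: "Q = mat2 a b b c" by (simp add: pqr selling2_def a_def b_def c_def)
  obtain p' q' r' where eq: "same_form 2 Q (selling2 p' q' r')" and "p' \<ge> 0" "q' \<ge> 0" "r' \<ge> 0"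
    using binary_obtuse_superbase[OF Q neg] .
  then have "det Q \<ge> 0" using same_form_det[OF eq] by (simp add: det_selling2)
  moreover have "det Q \<noteq> 0"
    using negative_definite_det_nonzero[OF _ neg] unfolding Qm by simp
  ultimately have det: "det Q = \<delta>" "\<delta> > 0" unfolding \<delta>_def by simp_all
  have "vec_of_list [c, - a] \<in> carrier_vec 2" by (intro carrier_vecI) simp
  then obtain x where x: "x \<in> carrier_vec 2" and cong: "vec_cong_mod2 2 (vec_of_list [c, - a]) x"
    and bound: "form_val Q x x + 2 \<ge> 1 - \<delta>"
      "\<not> same_form 2 Q (Delta_form 2 \<delta>) \<Longrightarrow> form_val Q x x + 2 > 1 - \<delta>"
    using binary_classes_bounded[OF Q neg] unfolding classes_bounded_def \<delta>_def by fastforce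
  define y where "y = vec_of_list [- (x $ 1), x $ 0]"
  have y: "y \<in> carrier_vec 2" "y $ 0 = - (x $ 1)" "y $ 1 = x $ 0"
    unfolding y_def by (auto intro: carrier_vecI)
  have x_eq: "vec_of_list [y $ 1, - (y $ 0)] = x"
    unfolding y(2,3) using x by (intro eq_vecI) (auto simp: less_2_cases_Suc)
  obtain z where z: "z \<in> carrier_vec 2" "vec_of_list [c, - a] - x = 2 \<cdot>\<^sub>v z"
    using cong unfolding vec_cong_mod2_def by blast
  have "c - x $ 0 = 2 * z $ 0" "- a - x $ 1 = 2 * z $ 1"
    using arg_cong[OF z(2), of "\<lambda>v. v $ 0"] arg_cong[OF z(2), of "\<lambda>v. v $ 1"] x z(1) by simp_all
  then have "y $ 0 - a = 2 * z $ 1" "y $ 1 - c = 2 * (- z $ 0)" unfolding y(2,3) by simp_all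
  then have covector: "characteristic_covector 2 Q y"
    unfolding Qm using y(1) by (intro characteristic_covector_binary) (simp_all add: cong_iff_dvd_diff)
  have dual: "dual_form_val Q y y = rat_of_int (form_val Q x x) / rat_of_int \<delta>"
    using dual_form_val_binary[OF Qm _ y(1)] det unfolding x_eq by simp
  have "dual_form_val Q y y + 2 - (1 - 1 / rat_of_int \<delta>)
      = rat_of_int (form_val Q x x + 2 - (1 - \<delta>)) / rat_of_int \<delta>"
    unfolding dual using det(2) by (simp add: field_simps)
  moreover have sign: "0 \<le> rat_of_int N / rat_of_int \<delta> \<longleftrightarrow> 0 \<le> N" "0 < rat_of_int N / rat_of_int \<delta> \<longleftrightarrow> 0 < N" for N
    using det(2) by (simp_all add: zero_le_divide_iff zero_less_divide_iff)
  ultimately have "dual_form_val Q y y + 2 \<ge> 1 - 1 / rat_of_int \<delta>"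
    and "\<not> same_form 2 Q (Delta_form 2 \<delta>) \<Longrightarrow> dual_form_val Q y y + 2 > 1 - 1 / rat_of_int \<delta>"
    using bound sign[of "form_val Q x x + 2 - (1 - \<delta>)"] by linarith+
  with covector show ?thesis using that by blast
qed

theorem proposition2p3:
  fixes n :: nat and Q :: "int mat" and \<delta> :: int
  assumes "n \<ge> 1"
    and "integral_form n Q"
    and "negative_definite n Q"
    and "\<delta> = \<bar>det Q\<bar>"
  shows
    "(n \<le> 3 \<longrightarrow>
        (\<forall>x\<^sub>0. characteristic_vector n Q x\<^sub>0 \<longrightarrow>
           (\<exists>x \<in> carrier_vec n. vec_cong_mod2 n x\<^sub>0 x
              \<and> form_val Q x x + int n \<ge> 1 - \<delta>
              \<and> (\<not> same_form n Q (Delta_form n \<delta>) \<longrightarrow> form_val Q x x + int n > 1 - \<delta>))))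
     \<and> (n = 2 \<and> odd \<delta> \<longrightarrow>
        (\<exists>y. characteristic_covector n Q y
              \<and> dual_form_val Q y y + rat_of_nat n \<ge> 1 - 1 / rat_of_int \<delta>
              \<and> (\<not> same_form n Q (Delta_form n \<delta>) \<longrightarrow>
                   dual_form_val Q y y + rat_of_nat n > 1 - 1 / rat_of_int \<delta>)))"
proof (intro conjI impI)
  assume "n \<le> 3"
  with assms(1) consider "n = 1" | "n = 2" | "n = 3" by linarith
  then have "classes_bounded n Q"
    using unary_classes_bounded binary_classes_bounded ternary_classes_bounded assms(2,3)
    by cases simp_all
  then show "\<forall>x\<^sub>0. characteristic_vector n Q x\<^sub>0 \<longrightarrow>
           (\<exists>x \<in> carrier_vec n. vec_cong_mod2 n x\<^sub>0 x
              \<and> form_val Q x x + int n \<ge> 1 - \<delta>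
              \<and> (\<not> same_form n Q (Delta_form n \<delta>) \<longrightarrow> form_val Q x x + int n > 1 - \<delta>))"
    unfolding classes_bounded_def characteristic_vector_def assms(4) by blast
next
  assume "n = 2 \<and> odd \<delta>"
  then have n: "n = 2" ..
  obtain y where "characteristic_covector 2 Q y"
    "dual_form_val Q y y + 2 \<ge> 1 - 1 / rat_of_int \<delta>"
    "\<not> same_form 2 Q (Delta_form 2 \<delta>) \<Longrightarrow> dual_form_val Q y y + 2 > 1 - 1 / rat_of_int \<delta>"
    using binary_covector_bounded[of Q] assms(2,3) unfolding n assms(4) by blast
  then show "\<exists>y. characteristic_covector n Q y
              \<and> dual_form_val Q y y + rat_of_nat n \<ge> 1 - 1 / rat_of_int \<delta>
              \<and> (\<not> same_form n Q (Delta_form n \<delta>) \<longrightarrow>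
                   dual_form_val Q y y + rat_of_nat n > 1 - 1 / rat_of_int \<delta>)"
    unfolding n by auto
qed

end
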